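(* Let $H$ be a separable Hilbert space, $\{H_i\}_{i\in I}$ a family of Hilbert spaces, and $C,C'$ bounded linear operators on $H$ with bounded inverses. Let $\Lambda=\{\Lambda_i\in\mathcal B(H,H_i)\}_{i\in I}$ and $\widetilde\Lambda=\{\widetilde\Lambda_i\in\mathcal B(H,H_i)\}_{i\in I}$ be a $CC'$-controlled g-dual pair, where $C^*\Lambda_i^*\Lambda_iC'$ and $C^*\widetilde\Lambda_i^*\widetilde\Lambda_iC'$ are positive for each $i\in I$. Let $J\subset I$ with complement $J^c$. If $f\in H$, then $$\sum_{i\in J}\big\langle (C^*\widetilde\Lambda_i^*\widetilde\Lambda_iC')^{1/2}f,(C^*\Lambda_i^*\Lambda_iC')^{1/2}f\big\rangle-\|S_Jf\|^2=\sum_{i\in J^c}\overline{\big\langle (C^*\widetilde\Lambda_i^*\widetilde\Lambda_iC')^{1/2}f,(C^*\Lambda_i^*\Lambda_iC')^{1/2}f\big\rangle}-\|S_{J^c}f\|^2.$$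
   Context: $\mathcal B(H,H_i)$ denotes the bounded linear operators from $H$ to $H_i$. $\Lambda$ is a $CC'$-controlled g-Bessel sequence if there is $B<\infty$ with $\sum_{i\in I}\langle \Lambda_iC'f,\Lambda_iCf\rangle\le B\|f\|^2$ for all $f\in H$. Let $K_\Lambda=\big\{\{(C^*\Lambda_i^*\Lambda_iC')^{1/2}f\}_{i\in I}: f\in H\big\}$, regarded as a closed subspace of the $\ell^2$-direct sum $(\sum_{i\in I}\oplus H_i)_{\ell^2}$. The synthesis operator is $T_\Lambda:K_\Lambda\to H$, $T_\Lambda(\{(C^*\Lambda_i^*\Lambda_iC')^{1/2}f\}_{i\in I})=\sum_{i\in I}C^*\Lambda_i^*\Lambda_iC'f$, and the analysis operator is $T_\Lambda^*:H\to K_\Lambda$, $T_\Lambda^*f=\{(C^*\Lambda_i^*\Lambda_iC')^{1/2}f\}_{i\in I}$; likewise for $\widetilde\Lambda$. $\Lambda,\widetilde\Lambda$ are a $CC'$-controlled g-dual pair if both are $CC'$-controlled g-Bessel sequences for $H$ and $T_\Lambda T_{\widetilde\Lambda}^*=\mathrm{Id}_H$. For $J\subset I$, the bounded operator $S_J$ on $H$ is defined by $S_Jf=\sum_{i\in J}(C^*\Lambda_i^*\Lambda_iC')^{1/2}(C^*\widetilde\Lambda_i^*\widetilde\Lambda_iC')^{1/2}f$, $f\in H$. *)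

theory Defs
  imports "HOL-Analysis.Analysis" "HOL-Library.Nonpos_Ints"
begin

text \<open>Complex inner product spaces; the inner product is linear in its first argument.\<close>

class complex_inner = real_normed_vector +
  fixes scaleC :: "complex \<Rightarrow> 'a \<Rightarrow> 'a"  (infixr \<open>*\<^sub>C\<close> 75)
    and cinner :: "'a \<Rightarrow> 'a \<Rightarrow> complex"
  assumes scaleC_add_right: "c *\<^sub>C (x + y) = c *\<^sub>C x + c *\<^sub>C y"
    and scaleC_add_left: "(c + d) *\<^sub>C x = c *\<^sub>C x + d *\<^sub>C x"
    and scaleC_scaleC: "c *\<^sub>C (d *\<^sub>C x) = (c * d) *\<^sub>C x"
    and scaleR_scaleC: "r *\<^sub>R x = complex_of_real r *\<^sub>C x"
    and cinner_commute: "cinner x y = cnj (cinner y x)"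
    and cinner_add_left: "cinner (x + y) z = cinner x z + cinner y z"
    and cinner_scaleC_left: "cinner (c *\<^sub>C x) y = c * cinner x y"
    and cinner_self: "cinner x x = complex_of_real ((norm x)\<^sup>2)"

class chilbert_space = complex_inner + complete_space

subclass (in chilbert_space) banach ..

instantiation complex :: chilbert_space
begin

definition scaleC_complex :: "complex \<Rightarrow> complex \<Rightarrow> complex"
  where "scaleC_complex c z = c * z"

definition cinner_complex :: "complex \<Rightarrow> complex \<Rightarrow> complex"
  where "cinner_complex z w = z * cnj w"

instance
proof
  fix x :: complex
  show "cinner x x = complex_of_real ((norm x)\<^sup>2)"
    unfolding cinner_complex_def by (rule complex_norm_square[symmetric])
qed (simp_all add: scaleC_complex_def cinner_complex_def scaleR_conv_of_real ring_distribs)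

end

definition csubspace :: "'a::complex_inner set \<Rightarrow> bool"
  where "csubspace V \<longleftrightarrow>
    0 \<in> V \<and> (\<forall>x\<in>V. \<forall>y\<in>V. x + y \<in> V) \<and> (\<forall>c. \<forall>x\<in>V. c *\<^sub>C x \<in> V)"

definition bounded_clinear :: "('a::complex_inner \<Rightarrow> 'b::complex_inner) \<Rightarrow> bool"
  where "bounded_clinear T \<longleftrightarrow> bounded_linear T \<and> (\<forall>c x. T (c *\<^sub>C x) = c *\<^sub>C T x)"

definition bounded_invertible :: "('a::complex_inner \<Rightarrow> 'a) \<Rightarrow> bool"
  where "bounded_invertible T \<longleftrightarrow>
    bounded_clinear T \<and> (\<exists>S. bounded_clinear S \<and> S \<circ> T = id \<and> T \<circ> S = id)"

text \<open>As for the real \<open>adjoint\<close> of the library, the choice is immaterial: the adjoint of a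
  bounded operator between Hilbert spaces exists and is unique.\<close>

definition cadjoint :: "('a::complex_inner \<Rightarrow> 'b::complex_inner) \<Rightarrow> 'b \<Rightarrow> 'a"
  where "cadjoint T = (SOME S. \<forall>x y. cinner (T x) y = cinner x (S y))"

definition positive_op :: "('a::complex_inner \<Rightarrow> 'a) \<Rightarrow> bool"
  where "positive_op T \<longleftrightarrow> (\<forall>f. cinner (T f) f \<in> \<real>\<^sub>\<ge>\<^sub>0)"

text \<open>The positive square root of a bounded positive operator on a Hilbert space exists and is
  unique, so the choice is again immaterial.\<close>

definition sqrt_op :: "('a::complex_inner \<Rightarrow> 'a) \<Rightarrow> 'a \<Rightarrow> 'a"
  where "sqrt_op T = (SOME S. bounded_clinear S \<and> positive_op S \<and> S \<circ> S = T)"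

lemma sqrt_op_sqrt_op:
  assumes "\<exists>S. bounded_clinear S \<and> positive_op S \<and> S \<circ> S = T"
  shows "sqrt_op T (sqrt_op T f) = T f"
proof -
  have "sqrt_op T \<circ> sqrt_op T = T"
    using someI_ex[OF assms] unfolding sqrt_op_def by blast
  from fun_cong[OF this, of f] show ?thesis
    unfolding comp_apply .
qed

text \<open>Throughout, the spaces \<open>H\<^sub>i\<close> are closed subspaces \<open>V i\<close> of one Hilbert space of type \<open>'k\<close>
  (every family of Hilbert spaces is of this form, inside its \<open>\<ell>\<^sup>2\<close>-direct sum), and an operator
  into \<open>V i\<close> is an operator into \<open>'k\<close> with range in \<open>V i\<close>. The adjoint \<open>V i \<rightarrow> H\<close> is then the
  restriction of the adjoint \<open>'k \<rightarrow> H\<close> to \<open>V i\<close>, so that \<open>\<Lambda>\<^sub>i\<^sup>* \<Lambda>\<^sub>i\<close> is unaffected.\<close>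

definition bounded_family ::
  "'i set \<Rightarrow> ('i \<Rightarrow> 'k::complex_inner set) \<Rightarrow> ('i \<Rightarrow> 'h::complex_inner \<Rightarrow> 'k) \<Rightarrow> bool"
  where "bounded_family I V \<Lambda> \<longleftrightarrow> (\<forall>i\<in>I. bounded_clinear (\<Lambda> i) \<and> range (\<Lambda> i) \<subseteq> V i)"

definition controlled_op ::
  "('h::complex_inner \<Rightarrow> 'h) \<Rightarrow> ('h \<Rightarrow> 'h) \<Rightarrow> ('h \<Rightarrow> 'k::complex_inner) \<Rightarrow> 'h \<Rightarrow> 'h"
  where "controlled_op C C' L = cadjoint C \<circ> cadjoint L \<circ> L \<circ> C'"

abbreviation controlled_root ::
  "('h::complex_inner \<Rightarrow> 'h) \<Rightarrow> ('h \<Rightarrow> 'h) \<Rightarrow> ('h \<Rightarrow> 'k::complex_inner) \<Rightarrow> 'h \<Rightarrow> 'h"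
  where "controlled_root C C' L \<equiv> sqrt_op (controlled_op C C' L)"

text \<open>The terms of the sum are complex numbers; the inequality means that the sum is a real
  number \<open>s\<close> with \<open>s \<le> B \<parallel>f\<parallel>\<^sup>2\<close>.\<close>

definition controlled_g_bessel ::
  "('h::complex_inner \<Rightarrow> 'h) \<Rightarrow> ('h \<Rightarrow> 'h) \<Rightarrow> 'i set \<Rightarrow> ('i \<Rightarrow> 'h \<Rightarrow> 'k::complex_inner) \<Rightarrow> bool"
  where "controlled_g_bessel C C' I \<Lambda> \<longleftrightarrow>
    (\<exists>B::real. \<forall>f. \<exists>s::real.
      ((\<lambda>i. cinner (\<Lambda> i (C' f)) (\<Lambda> i (C f))) has_sum complex_of_real s) I \<and>
      s \<le> B * (norm f)\<^sup>2)"

definition analysis_op ::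
  "('h::complex_inner \<Rightarrow> 'h) \<Rightarrow> ('h \<Rightarrow> 'h) \<Rightarrow> ('i \<Rightarrow> 'h \<Rightarrow> 'k::complex_inner) \<Rightarrow> 'h \<Rightarrow> 'i \<Rightarrow> 'h"
  where "analysis_op C C' \<Lambda> f = (\<lambda>i. controlled_root C C' (\<Lambda> i) f)"

text \<open>The synthesis operator is usually given only on the sequences \<open>analysis_op C C' \<Lambda> f\<close>, by
  \<open>\<Sum>\<^sub>i C\<^sup>* \<Lambda>\<^sub>i\<^sup>* \<Lambda>\<^sub>i C' f\<close>. To compose it with the analysis operator of another family it has to be
  defined on all square-summable sequences in \<open>H\<close>, as the adjoint of the analysis operator.
  Lemma \<open>synthesis_analysis\<close> is the usual formula.\<close>

definition synthesis_op ::
  "('h::complex_inner \<Rightarrow> 'h) \<Rightarrow> ('h \<Rightarrow> 'h) \<Rightarrow> 'i set \<Rightarrow> ('i \<Rightarrow> 'h \<Rightarrow> 'k::complex_inner) \<Rightarrow>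
    ('i \<Rightarrow> 'h) \<Rightarrow> 'h"
  where "synthesis_op C C' I \<Lambda> g = (\<Sum>\<^sub>\<infinity>i\<in>I. controlled_root C C' (\<Lambda> i) (g i))"

lemma synthesis_analysis:
  assumes "\<And>i. i \<in> I \<Longrightarrow>
    \<exists>S. bounded_clinear S \<and> positive_op S \<and> S \<circ> S = controlled_op C C' (\<Lambda> i)"
  shows "synthesis_op C C' I \<Lambda> (analysis_op C C' \<Lambda> f) = (\<Sum>\<^sub>\<infinity>i\<in>I. controlled_op C C' (\<Lambda> i) f)"
proof -
  have "controlled_root C C' (\<Lambda> i) (controlled_root C C' (\<Lambda> i) f) =
      controlled_op C C' (\<Lambda> i) f" if "i \<in> I" for i
    using sqrt_op_sqrt_op[OF assms[OF that]] .
  then show ?thesis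
    unfolding synthesis_op_def analysis_op_def by (intro infsum_cong) simp
qed

definition controlled_g_dual_pair ::
  "('h::complex_inner \<Rightarrow> 'h) \<Rightarrow> ('h \<Rightarrow> 'h) \<Rightarrow> 'i set \<Rightarrow>
    ('i \<Rightarrow> 'h \<Rightarrow> 'k::complex_inner) \<Rightarrow> ('i \<Rightarrow> 'h \<Rightarrow> 'k) \<Rightarrow> bool"
  where "controlled_g_dual_pair C C' I \<Lambda> \<Lambda>' \<longleftrightarrow>
    controlled_g_bessel C C' I \<Lambda> \<and> controlled_g_bessel C C' I \<Lambda>' \<and>
    synthesis_op C C' I \<Lambda> \<circ> analysis_op C C' \<Lambda>' = id"

definition partial_op ::
  "('h::complex_inner \<Rightarrow> 'h) \<Rightarrow> ('h \<Rightarrow> 'h) \<Rightarrow> ('i \<Rightarrow> 'h \<Rightarrow> 'k::complex_inner) \<Rightarrow>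
    ('i \<Rightarrow> 'h \<Rightarrow> 'k) \<Rightarrow> 'i set \<Rightarrow> 'h \<Rightarrow> 'h"
  where "partial_op C C' \<Lambda> \<Lambda>' J f =
    (\<Sum>\<^sub>\<infinity>i\<in>J. controlled_root C C' (\<Lambda> i) (controlled_root C C' (\<Lambda>' i) f))"

end

(* Write R_i and R'_i for the positive roots of the controlled operators of the two families.
   The Bessel bound for the R_i makes the series of the R_i (R'_i f) unconditionally convergent,
   so S_J f + S_(I - J) f = f by duality, and self-adjointness of the roots gives
   sum_(i in J) <R'_i f, R_i f> = <S_J f, f>. Both sides of the identity therefore equal
   <S_J f, S_(I - J) f>. The adjoints and positive square roots chosen in the definitions exist by
   the Riesz representation theorem and by the iteration X_(n+1) = (B + X_n^2) / 2 with
   B = 1 - A / c, whose limit X gives the root c^(1/2) (1 - X) of A. *)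

theory Submission
  imports Defs
begin

section \<open>Complex inner products and the Cauchy-Schwarz inequality\<close>

lemma cinner_add_right: "cinner x (y + z) = cinner x y + cinner x (z::'a::complex_inner)"
  by (metis cinner_add_left cinner_commute complex_cnj_add)

lemma cinner_scaleC_right: "cinner x (c *\<^sub>C y) = cnj c * cinner x (y::'a::complex_inner)"
  by (metis cinner_commute cinner_scaleC_left complex_cnj_mult)

lemma cinner_scaleR_left: "cinner (r *\<^sub>R x) y = complex_of_real r * cinner x (y::'a::complex_inner)"
  by (simp add: scaleR_scaleC cinner_scaleC_left)

lemma cinner_scaleR_right: "cinner x (r *\<^sub>R y) = complex_of_real r * cinner x (y::'a::complex_inner)"
  by (simp add: scaleR_scaleC cinner_scaleC_right)

lemma cinner_minus_left: "cinner (- x) y = - cinner x (y::'a::complex_inner)"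
  using cinner_scaleR_left[of "-1" x y] by simp

lemma cinner_minus_right: "cinner x (- y) = - cinner x (y::'a::complex_inner)"
  using cinner_scaleR_right[of x "-1" y] by simp

lemma cinner_diff_left: "cinner (x - y) z = cinner x z - cinner y (z::'a::complex_inner)"
  using cinner_add_left[of x "- y" z] by (simp add: cinner_minus_left)

lemma cinner_diff_right: "cinner x (y - z) = cinner x y - cinner x (z::'a::complex_inner)"
  using cinner_add_right[of x y "- z"] by (simp add: cinner_minus_right)

lemmas cinner_simps = cinner_add_left cinner_add_right cinner_diff_left cinner_diff_right
  cinner_minus_left cinner_minus_right cinner_scaleC_left cinner_scaleC_right
  cinner_scaleR_left cinner_scaleR_right

text \<open>The norm axioms treat real scalars only. Complex homogeneity comes from
  \<open>cinner_self\<close>: both sides are nonnegative and have the same square.\<close>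

lemma norm_scaleC: "norm (c *\<^sub>C x) = cmod c * norm (x::'a::complex_inner)"
proof -
  have "complex_of_real ((norm (c *\<^sub>C x))\<^sup>2) = complex_of_real ((cmod c * norm x)\<^sup>2)"
    using cinner_self[of "c *\<^sub>C x"] cinner_self[of x] complex_norm_square[of c]
    by (simp add: cinner_simps power_mult_distrib mult_ac)
  then have "(norm (c *\<^sub>C x))\<^sup>2 = (cmod c * norm x)\<^sup>2"
    using of_real_eq_iff by blast
  then show ?thesis
    by (simp add: power2_eq_iff_nonneg)
qed

lemma scaleC_diff_right: "c *\<^sub>C (x - y) = c *\<^sub>C x - c *\<^sub>C (y::'a::complex_inner)"
  by (metis add_diff_cancel diff_add_cancel scaleC_add_right)

lemma scaleC_scaleR: "c *\<^sub>C (r *\<^sub>R x) = r *\<^sub>R (c *\<^sub>C (x::'a::complex_inner))"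
  by (simp add: scaleR_scaleC scaleC_scaleC mult.commute)

lemma norm_sq_diff:
  "(norm (x - y))\<^sup>2 = (norm x)\<^sup>2 - 2 * Re (cinner x y) + (norm (y::'a::complex_inner))\<^sup>2"
proof -
  have "Re (cinner y x) = Re (cinner x y)"
    by (metis cinner_commute complex_cnj cnj.sel(1))
  moreover have "Re (cinner (x - y) (x - y)) =
      Re (cinner x x) - Re (cinner x y) - Re (cinner y x) + Re (cinner y y)"
    by (simp add: cinner_simps)
  ultimately show ?thesis
    by (simp add: cinner_self)
qed

lemma norm_sq_add:
  "(norm (x + y))\<^sup>2 = (norm x)\<^sup>2 + 2 * Re (cinner x y) + (norm (y::'a::complex_inner))\<^sup>2"
  using norm_sq_diff[of x "- y"] by (simp add: cinner_simps)

text \<open>The triangle inequality is already an axiom of the norm, so expanding the square of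
  \<open>norm (x + y)\<close> yields the real part of Cauchy-Schwarz.\<close>

lemma Re_cinner_le: "Re (cinner x y) \<le> norm x * norm (y::'a::complex_inner)"
proof -
  have "(norm (x + y))\<^sup>2 \<le> (norm x + norm y)\<^sup>2"
    by (intro power_mono norm_triangle_ineq) simp
  then show ?thesis
    by (simp add: norm_sq_add power2_sum)
qed

text \<open>A scalar \<open>u\<close> of modulus 1 rotates \<open>cinner x y\<close> onto its
  modulus. The real-part inequality for \<open>u *\<^sub>C x\<close> and \<open>y\<close> then
  bounds the modulus.\<close>

lemma norm_cinner_le: "cmod (cinner x y) \<le> norm x * norm (y::'a::complex_inner)"
proof (cases "cinner x y = 0")
  case False
  define u where "u = cnj (cinner x y) / complex_of_real (cmod (cinner x y))"
  have "cmod u = 1"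
    using False by (simp add: u_def norm_divide)
  have "u * cinner x y = complex_of_real (cmod (cinner x y))"
    using False complex_norm_square[of "cinner x y"]
    by (simp add: u_def field_simps power2_eq_square)
  then have "cmod (cinner x y) = Re (cinner (u *\<^sub>C x) y)"
    by (simp add: cinner_simps)
  also have "\<dots> \<le> norm (u *\<^sub>C x) * norm y"
    by (rule Re_cinner_le)
  finally show ?thesis
    by (simp add: norm_scaleC \<open>cmod u = 1\<close>)
qed simp

lemma bounded_bilinear_cinner: "bounded_bilinear (cinner :: 'a::complex_inner \<Rightarrow> 'a \<Rightarrow> complex)"
proof
  show "\<exists>K. \<forall>a b::'a. cmod (cinner a b) \<le> norm a * norm b * K"
    using norm_cinner_le by (intro exI[of _ 1]) auto
qed (simp_all add: cinner_simps scaleR_conv_of_real)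

lemma cinner_eqI:
  fixes y z :: "'a::complex_inner"
  assumes "\<And>x. cinner x y = cinner x z"
  shows "y = z"
proof -
  have "cinner (y - z) (y - z) = 0"
    using assms by (simp add: cinner_diff_right)
  then show ?thesis
    by (simp add: cinner_self)
qed

section \<open>Riesz representation and adjoints\<close>

lemma parallelogram:
  "(norm (x + y))\<^sup>2 + (norm (x - y))\<^sup>2 = 2 * (norm x)\<^sup>2 + 2 * (norm (y::'a::complex_inner))\<^sup>2"
  by (simp add: norm_sq_add norm_sq_diff)

text \<open>The representing vector minimises \<open>\<parallel>x\<parallel>\<^sup>2 - 2 \<phi> x\<close>.\<close>

lemma riesz_representation_real:
  fixes \<phi> :: "'a::chilbert_space \<Rightarrow> real"
  assumes "bounded_linear \<phi>"
  shows "\<exists>z. \<forall>x. \<phi> x = Re (cinner x z)"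
proof -
  interpret bounded_linear \<phi> by fact
  define q where "q x = (norm x)\<^sup>2 - 2 * \<phi> x" for x
  obtain K where K: "\<And>x. norm (\<phi> x) \<le> norm x * K"
    using bounded by blast
  \<comment> \<open>Completing the square: \<open>q x\<close> is at least
    \<open>(norm x)\<^sup>2 - 2 * K * norm x\<close>.\<close>
  have "- K\<^sup>2 \<le> q x" for x
  proof -
    have "0 \<le> (norm x - K)\<^sup>2" by simp
    then show ?thesis
      using K[of x] by (simp add: q_def power2_diff algebra_simps)
  qed
  then have bdd: "bdd_below (range q)"
    by (intro bdd_belowI[of _ "- K\<^sup>2"]) auto
  define m where "m = (INF x. q x)"
  have m_le: "m \<le> q x" for x
    unfolding m_def by (rule cINF_lower[OF bdd]) simp
  have "\<exists>x. q x < m + inverse (real (Suc n))" for n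
    using cINF_less_iff[OF _ bdd, of "m + inverse (real (Suc n))"] unfolding m_def by auto
  then obtain X where X: "\<And>n. q (X n) < m + inverse (real (Suc n))"
    by metis
  \<comment> \<open>The midpoint of \<open>x\<close> and \<open>y\<close> also has value at least
    \<open>m\<close>. With the parallelogram law this forces near-minimisers to lie close
    together.\<close>
  have mid: "(norm (x - y))\<^sup>2 \<le> 2 * (q x - m) + 2 * (q y - m)" for x y
  proof -
    have "norm ((1/2) *\<^sub>R (x + y)) = norm (x + y) / 2" "\<phi> ((1/2) *\<^sub>R (x + y)) = (\<phi> x + \<phi> y) / 2"
      by (simp_all only: norm_scaleR scaleR add) auto
    then have "q ((1/2) *\<^sub>R (x + y)) = (norm (x + y))\<^sup>2 / 4 - \<phi> x - \<phi> y"
      unfolding q_def by (simp only:) (simp add: power_divide field_simps)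
    with m_le[of "(1/2) *\<^sub>R (x + y)"] parallelogram[of x y] show ?thesis
      by (simp add: q_def)
  qed
  have "Cauchy X"
  proof (rule metric_CauchyI)
    fix e :: real assume "0 < e"
    \<comment> \<open>With both excesses over \<open>m\<close> below \<open>e\<^sup>2 / 4\<close>,
      the bound \<open>mid\<close> adds up to \<open>e\<^sup>2\<close>.\<close>
    then obtain N where N: "inverse (real (Suc N)) < e\<^sup>2 / 4"
      using reals_Archimedean[of "e\<^sup>2 / 4"] by auto
    have "dist (X i) (X j) < e" if "N \<le> i" "N \<le> j" for i j
    proof -
      have "q (X k) - m < e\<^sup>2 / 4" if "N \<le> k" for k
      proof -
        have "q (X k) - m < inverse (real (Suc k))"
          using X[of k] by simp
        also have "\<dots> \<le> inverse (real (Suc N))"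
          using that by (intro le_imp_inverse_le) auto
        also note N
        finally show ?thesis .
      qed
      from this[OF that(1)] this[OF that(2)]
      have "(norm (X i - X j))\<^sup>2 < e\<^sup>2"
        using mid[of "X i" "X j"] by argo
      then show ?thesis
        using \<open>0 < e\<close> by (simp add: dist_norm power_less_imp_less_base)
    qed
    then show "\<exists>M. \<forall>i\<ge>M. \<forall>j\<ge>M. dist (X i) (X j) < e" by blast
  qed
  then obtain z where z: "X \<longlonglongrightarrow> z"
    using Cauchy_convergent convergent_def by blast
  have "(\<lambda>n. q (X n)) \<longlonglongrightarrow> q z"
    unfolding q_def by (intro tendsto_intros tendsto z)
  moreover have "(\<lambda>n. m + inverse (real (Suc n))) \<longlonglongrightarrow> m + 0"
    by (intro tendsto_intros LIMSEQ_inverse_real_of_nat)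
  ultimately have "q z \<le> m + 0"
    using X by (intro LIMSEQ_le[of "\<lambda>n. q (X n)"]) (auto intro: less_imp_le)
  then have min: "q z \<le> q y" for y
    using m_le[of y] by simp
  \<comment> \<open>The right-hand side is \<open>q (z + t *\<^sub>R x) - q z\<close>.\<close>
  have ineq: "0 \<le> 2 * t * (Re (cinner x z) - \<phi> x) + t\<^sup>2 * (norm x)\<^sup>2" for x t
  proof -
    have "Re (cinner z x) = Re (cinner x z)"
      by (metis cinner_commute cnj.sel(1))
    then show ?thesis
      using min[of "z + t *\<^sub>R x"]
      by (simp add: q_def norm_sq_add cinner_simps add scaleR power_mult_distrib algebra_simps)
  qed
  have "\<phi> x = Re (cinner x z)" for x
  proof (rule ccontr)
    define d where "d = Re (cinner x z) - \<phi> x"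
    \<comment> \<open>The quadratic in \<open>ineq\<close> is smallest at
      \<open>t = - d / (norm x)\<^sup>2\<close>. Adding 1 to the denominator avoids a case split at
      \<open>x = 0\<close> and still gives a value of at most \<open>- d\<^sup>2 / s\<close>, which
      is negative.\<close>
    define s where "s = (norm x)\<^sup>2 + 1"
    assume "\<phi> x \<noteq> Re (cinner x z)"
    then have "d \<noteq> 0" by (simp add: d_def)
    have "0 < s" by (simp add: s_def add_nonneg_pos)
    have "0 \<le> 2 * (- d / s) * d + (- d / s)\<^sup>2 * (norm x)\<^sup>2"
      using ineq[of "- d / s" x] unfolding d_def .
    also have "\<dots> \<le> 2 * (- d / s) * d + (- d / s)\<^sup>2 * s"
      by (intro add_left_mono mult_left_mono) (simp_all add: s_def)
    also have "\<dots> = - d\<^sup>2 / s"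
      using \<open>0 < s\<close> by (simp add: field_simps power2_eq_square)
    finally show False
      using \<open>d \<noteq> 0\<close> \<open>0 < s\<close> by (simp add: field_simps)
  qed
  then show ?thesis by blast
qed

text \<open>Riesz represents the real part of \<open>cinner (T x) y\<close>. Replacing
  \<open>x\<close> by \<open>\<i> *\<^sub>C x\<close> recovers the imaginary part with the same
  vector, so the choice in \<open>cadjoint\<close> has a witness.\<close>

lemma cinner_cadjoint:
  fixes T :: "'a::chilbert_space \<Rightarrow> 'b::complex_inner"
  assumes "bounded_clinear T"
  shows "cinner (T x) y = cinner x (cadjoint T y)"
proof -
  have T: "bounded_linear T" and TC: "T (c *\<^sub>C x) = c *\<^sub>C T x" for c x
    using assms by (auto simp: bounded_clinear_def)
  have "\<exists>z. \<forall>x. cinner (T x) y = cinner x z" for y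
  proof -
    have "bounded_linear (\<lambda>x. Re (cinner (T x) y))"
      by (rule bounded_linear_compose[OF bounded_linear_Re])
        (rule bounded_linear_compose[OF bounded_bilinear.bounded_linear_left[OF bounded_bilinear_cinner] T])
    then obtain z where z: "Re (cinner (T x) y) = Re (cinner x z)" for x
      using riesz_representation_real by metis
    have "cinner (T x) y = cinner x z" for x
      using z[of x] z[of "\<i> *\<^sub>C x"] by (simp add: TC cinner_simps complex_eq_iff)
    then show ?thesis by blast
  qed
  then have "\<exists>S. \<forall>x y. cinner (T x) y = cinner x (S y)"
    by metis
  from someI_ex[OF this] show ?thesis
    unfolding cadjoint_def by blast
qed

text \<open>Linearity follows because a vector is determined by its inner products. Pairing
  \<open>cadjoint T y\<close> with itself and moving \<open>T\<close> across gives the bound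
  \<open>onorm T\<close>, after cancelling one factor of its norm.\<close>

lemma bounded_clinear_cadjoint:
  fixes T :: "'a::chilbert_space \<Rightarrow> 'b::complex_inner"
  assumes "bounded_clinear T"
  shows "bounded_clinear (cadjoint T)"
proof -
  note adj = cinner_cadjoint[OF assms, symmetric]
  have T: "bounded_linear T"
    using assms by (simp add: bounded_clinear_def)
  have scaleC: "cadjoint T (c *\<^sub>C y) = c *\<^sub>C cadjoint T y" for c y
    by (rule cinner_eqI) (simp add: adj cinner_simps)
  have bound: "norm (cadjoint T y) \<le> norm y * onorm T" for y
  proof (cases "cadjoint T y = 0")
    case False
    have "(norm (cadjoint T y))\<^sup>2 = Re (cinner (T (cadjoint T y)) y)"
      by (simp add: adj[symmetric] cinner_self)
    also have "\<dots> \<le> norm (T (cadjoint T y)) * norm y"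
      by (rule Re_cinner_le)
    also have "\<dots> \<le> (onorm T * norm (cadjoint T y)) * norm y"
      by (intro mult_right_mono onorm[OF T]) simp
    finally show ?thesis
      using False by (simp add: power2_eq_square mult_ac)
  qed (simp add: onorm_pos_le[OF T])
  have "bounded_linear (cadjoint T)"
  proof
    show "\<exists>K. \<forall>y. norm (cadjoint T y) \<le> norm y * K"
      using bound by blast
  next
    show "cadjoint T (x + y) = cadjoint T x + cadjoint T y" for x y
      by (rule cinner_eqI) (simp add: adj cinner_simps)
    show "cadjoint T (r *\<^sub>R x) = r *\<^sub>R cadjoint T x" for r x
      by (simp add: scaleR_scaleC scaleC)
  qed
  then show ?thesis
    by (simp add: bounded_clinear_def scaleC)
qed

section \<open>Controlled operators and positive operators\<close>

lemma bounded_clinear_compose: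
  "bounded_clinear S \<Longrightarrow> bounded_clinear T \<Longrightarrow> bounded_clinear (S \<circ> T)"
  unfolding bounded_clinear_def by (auto simp: o_def intro: bounded_linear_compose)

lemma bounded_clinear_controlled_op:
  fixes C C' :: "'h::chilbert_space \<Rightarrow> 'h" and L :: "'h \<Rightarrow> 'k::chilbert_space"
  assumes "bounded_clinear C" "bounded_clinear C'" "bounded_clinear L"
  shows "bounded_clinear (controlled_op C C' L)"
  unfolding controlled_op_def
  by (rule bounded_clinear_compose[OF bounded_clinear_compose[OF bounded_clinear_compose[OF
      bounded_clinear_cadjoint[OF assms(1)] bounded_clinear_cadjoint[OF assms(3)]] assms(3)] assms(2)])

text \<open>This identifies the terms of the Bessel sum with the quadratic forms of the controlled
  operators.\<close>

lemma cinner_controlled_op: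
  fixes C C' :: "'h::chilbert_space \<Rightarrow> 'h" and L :: "'h \<Rightarrow> 'k::chilbert_space"
  assumes "bounded_clinear C" "bounded_clinear L"
  shows "cinner (controlled_op C C' L f) f = cinner (L (C' f)) (L (C f))"
proof -
  have "cinner f (controlled_op C C' L f) = cinner (L (C f)) (L (C' f))"
    by (simp add: controlled_op_def cinner_cadjoint[OF assms(1)] cinner_cadjoint[OF assms(2)])
  then show ?thesis
    by (metis cinner_commute)
qed

text \<open>Polarisation: over the complex field, a real quadratic form is Hermitian.\<close>

lemma positive_op_symmetric:
  fixes T :: "'a::complex_inner \<Rightarrow> 'a"
  assumes "bounded_clinear T" "positive_op T"
  shows "cinner (T x) y = cinner x (T y)"
proof -
  have T: "bounded_linear T" and TC: "T (c *\<^sub>C x) = c *\<^sub>C T x" for c x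
    using assms by (auto simp: bounded_clinear_def)
  have real: "Im (cinner (T x) x) = 0" for x
    using assms(2) by (simp add: positive_op_def complex_nonneg_Reals_iff)
  note add = linear_add[OF bounded_linear.linear[OF T]]
  \<comment> \<open>The vector \<open>x + y\<close> relates the imaginary parts of the two mixed
    terms; below, \<open>\<i> *\<^sub>C x + y\<close> relates their real parts.\<close>
  have "Im (cinner (T x) y) + Im (cinner (T y) x) = 0"
    using real[of "x + y"] real[of x] real[of y] by (simp add: add cinner_simps)
  moreover have "Re (cinner (T x) y) = Re (cinner (T y) x)"
    using real[of "\<i> *\<^sub>C x + y"] real[of x] real[of y] by (simp add: add TC cinner_simps)
  ultimately have "cinner (T x) y = cnj (cinner (T y) x)"
    by (simp add: complex_eq_iff)
  then show ?thesis
    by (metis cinner_commute)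
qed

text \<open>The quadratic form is nonnegative at \<open>y = x - (1/c) *\<^sub>R T x\<close>. In its
  expansion the term quadratic in \<open>1/c\<close> is at most
  \<open>(norm (T x))\<^sup>2 / c\<close>, as \<open>onorm T \<le> c\<close>, and so absorbs only
  half of the mixed term. The bound is what makes \<open>1 - T / c\<close> a contraction.\<close>

lemma positive_op_norm_sq_le:
  fixes T :: "'a::complex_inner \<Rightarrow> 'a"
  assumes "bounded_clinear T" "positive_op T" and c: "0 < c" "onorm T \<le> c"
  shows "(norm (T x))\<^sup>2 \<le> c * Re (cinner (T x) x)"
proof -
  have T: "bounded_linear T"
    using assms(1) by (simp add: bounded_clinear_def)
  note lin = bounded_linear.linear[OF T]
  define y where "y = x - (1/c) *\<^sub>R T x"
  have "0 \<le> Re (cinner (T y) y)"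
    using assms(2) by (simp add: positive_op_def complex_nonneg_Reals_iff)
  also have "T y = T x - (1/c) *\<^sub>R T (T x)"
    by (simp add: y_def linear_diff[OF lin] linear_scale[OF lin])
  also have "Re (cinner (T x - (1/c) *\<^sub>R T (T x)) y) =
      Re (cinner (T x) x) - 2 * (norm (T x))\<^sup>2 / c + Re (cinner (T (T x)) (T x)) / c\<^sup>2"
    using positive_op_symmetric[OF assms(1,2), of "T x" x]
    by (simp add: y_def cinner_simps cinner_self power2_eq_square algebra_simps)
  finally have "0 \<le> Re (cinner (T x) x) - 2 * (norm (T x))\<^sup>2 / c + Re (cinner (T (T x)) (T x)) / c\<^sup>2" .
  moreover have "Re (cinner (T (T x)) (T x)) / c\<^sup>2 \<le> (norm (T x))\<^sup>2 / c"
  proof -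
    have "Re (cinner (T (T x)) (T x)) \<le> norm (T (T x)) * norm (T x)"
      by (rule Re_cinner_le)
    also have "\<dots> \<le> (onorm T * norm (T x)) * norm (T x)"
      by (intro mult_right_mono onorm[OF T]) simp
    also have "\<dots> \<le> (c * norm (T x)) * norm (T x)"
      by (intro mult_right_mono c) simp_all
    finally show ?thesis
      using c by (simp add: field_simps power2_eq_square)
  qed
  ultimately have "0 \<le> Re (cinner (T x) x) - (norm (T x))\<^sup>2 / c"
    by (simp add: field_simps)
  then show ?thesis
    using c by (simp add: field_simps)
qed

section \<open>Square roots of positive operators\<close>

text \<open>A fixed point \<open>X\<close> of this iteration satisfies \<open>(1 - X)\<^sup>2 = 1 - B\<close>. The scalar iteration
  with \<open>B = 1\<close> dominates the operator iteration started with any \<open>B\<close> of norm at most \<open>1\<close>.\<close>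

primrec sqrt_iter :: "('a::real_normed_vector \<Rightarrow>\<^sub>L 'a) \<Rightarrow> nat \<Rightarrow> 'a \<Rightarrow>\<^sub>L 'a" where
  "sqrt_iter B 0 = 0"
| "sqrt_iter B (Suc n) = (1/2) *\<^sub>R (B + (sqrt_iter B n o\<^sub>L sqrt_iter B n))"

primrec sqrt_iter_real :: "nat \<Rightarrow> real" where
  "sqrt_iter_real 0 = 0"
| "sqrt_iter_real (Suc n) = (1 + (sqrt_iter_real n)\<^sup>2) / 2"

lemma sqrt_iter_real_bounds: "0 \<le> sqrt_iter_real n" "sqrt_iter_real n \<le> 1"
proof -
  have "0 \<le> sqrt_iter_real n \<and> sqrt_iter_real n \<le> 1"
    by (induction n) (auto simp: power_le_one)
  then show "0 \<le> sqrt_iter_real n" "sqrt_iter_real n \<le> 1" by auto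
qed

text \<open>Each increment is half of \<open>(sqrt_iter_real n - 1)\<^sup>2\<close>.\<close>

lemma incseq_sqrt_iter_real: "incseq sqrt_iter_real"
proof (rule incseq_SucI)
  fix n
  have "0 \<le> (sqrt_iter_real n - 1)\<^sup>2" by simp
  then show "sqrt_iter_real n \<le> sqrt_iter_real (Suc n)"
    by (simp add: power2_eq_square algebra_simps)
qed

lemma norm_sqrt_iter_le:
  assumes "norm B \<le> 1"
  shows "norm (sqrt_iter B n) \<le> sqrt_iter_real n"
proof (induction n)
  case (Suc n)
  have "norm (sqrt_iter B (Suc n)) \<le> (norm B + norm (sqrt_iter B n o\<^sub>L sqrt_iter B n)) / 2"
    using norm_triangle_ineq[of B "sqrt_iter B n o\<^sub>L sqrt_iter B n"] by simp
  also have "\<dots> \<le> (1 + sqrt_iter_real n * sqrt_iter_real n) / 2"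
  proof -
    have "norm (sqrt_iter B n o\<^sub>L sqrt_iter B n) \<le> norm (sqrt_iter B n) * norm (sqrt_iter B n)"
      by (rule norm_blinfun_compose)
    also have "\<dots> \<le> sqrt_iter_real n * sqrt_iter_real n"
      by (intro mult_mono Suc.IH sqrt_iter_real_bounds) simp
    finally show ?thesis using assms by simp
  qed
  finally show ?case by (simp add: power2_eq_square)
qed simp

text \<open>The difference of squares splits as \<open>(X - Y) X + Y (X - Y)\<close>, without
  assuming that \<open>X\<close> and \<open>Y\<close> commute. The scalar increments have the same
  splitting, so the domination passes from one step to the next.\<close>

lemma norm_sqrt_iter_diff_le:
  assumes "norm B \<le> 1"
  shows "norm (sqrt_iter B (Suc n) - sqrt_iter B n) \<le> sqrt_iter_real (Suc n) - sqrt_iter_real n"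
proof (induction n)
  case 0
  then show ?case using assms by simp
next
  case (Suc n)
  define X Y where "X = sqrt_iter B (Suc n)" and "Y = sqrt_iter B n"
  define x y where "x = sqrt_iter_real (Suc n)" and "y = sqrt_iter_real n"
  note bounds = norm_sqrt_iter_le[OF assms, of "Suc n", folded X_def x_def]
    norm_sqrt_iter_le[OF assms, of n, folded Y_def y_def]
  have diff: "norm (X - Y) \<le> x - y"
    using Suc.IH unfolding X_def Y_def x_def y_def .
  have "sqrt_iter B (Suc (Suc n)) - sqrt_iter B (Suc n) =
      (1/2) *\<^sub>R (B + (X o\<^sub>L X)) - (1/2) *\<^sub>R (B + (Y o\<^sub>L Y))"
    unfolding X_def Y_def by (simp only: sqrt_iter.simps)
  also have "\<dots> = (1/2) *\<^sub>R (((X - Y) o\<^sub>L X) + (Y o\<^sub>L (X - Y)))"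
    by (rule blinfun_eqI) (simp add: blinfun.bilinear_simps scaleR_diff_right scaleR_add_right)
  also have "norm \<dots> \<le> (norm ((X - Y) o\<^sub>L X) + norm (Y o\<^sub>L (X - Y))) / 2"
    using norm_triangle_ineq[of "(X - Y) o\<^sub>L X" "Y o\<^sub>L (X - Y)"] by simp
  also have "\<dots> \<le> ((x - y) * x + y * (x - y)) / 2"
  proof -
    have "norm ((X - Y) o\<^sub>L X) \<le> norm (X - Y) * norm X"
      by (rule norm_blinfun_compose)
    also have "\<dots> \<le> (x - y) * x"
      using diff norm_ge_zero[of "X - Y"] by (intro mult_mono bounds diff) (linarith, simp)
    finally have 1: "norm ((X - Y) o\<^sub>L X) \<le> (x - y) * x" .
    have "norm (Y o\<^sub>L (X - Y)) \<le> norm Y * norm (X - Y)"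
      by (rule norm_blinfun_compose)
    also have "\<dots> \<le> y * (x - y)"
      by (intro mult_mono bounds diff) (simp_all add: y_def sqrt_iter_real_bounds)
    finally show ?thesis using 1 by simp
  qed
  also have "\<dots> = sqrt_iter_real (Suc (Suc n)) - sqrt_iter_real (Suc n)"
    unfolding sqrt_iter_real.simps(2)[of "Suc n"] x_def[symmetric]
    unfolding x_def sqrt_iter_real.simps(2)[of n] y_def[symmetric]
    by (simp add: power2_eq_square field_simps)
  finally show ?case .
qed

text \<open>Telescoping bounds the distance of two iterates by that of the scalar iterates, which
  are monotone and bounded and hence Cauchy.\<close>

lemma Cauchy_sqrt_iter:
  fixes B :: "'a::real_normed_vector \<Rightarrow>\<^sub>L 'a"
  assumes "norm B \<le> 1"
  shows "Cauchy (sqrt_iter B)"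
proof -
  have dist: "norm (sqrt_iter B (m + k) - sqrt_iter B m) \<le> sqrt_iter_real (m + k) - sqrt_iter_real m"
    for m k
  proof (induction k)
    case (Suc k)
    have "norm (sqrt_iter B (m + Suc k) - sqrt_iter B m) \<le>
        norm (sqrt_iter B (Suc (m + k)) - sqrt_iter B (m + k)) +
        norm (sqrt_iter B (m + k) - sqrt_iter B m)"
      using norm_triangle_ineq[of "sqrt_iter B (Suc (m + k)) - sqrt_iter B (m + k)"
          "sqrt_iter B (m + k) - sqrt_iter B m"] by (simp del: sqrt_iter.simps)
    then show ?case
      using Suc.IH norm_sqrt_iter_diff_le[OF assms, of "m + k"]
      by (simp del: sqrt_iter.simps sqrt_iter_real.simps)
  qed simp
  have "Cauchy sqrt_iter_real"
    by (rule convergent_Cauchy, rule Bseq_monoseq_convergent)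
      (use incseq_sqrt_iter_real sqrt_iter_real_bounds in
        \<open>auto intro!: BseqI'[of _ 1] simp: monoseq_iff\<close>)
  show ?thesis
  proof (rule CauchyI')
    fix e :: real assume "0 < e"
    then obtain M where "\<And>m n. M \<le> m \<Longrightarrow> M \<le> n \<Longrightarrow> norm (sqrt_iter_real m - sqrt_iter_real n) < e"
      using CauchyD[OF \<open>Cauchy sqrt_iter_real\<close>] by metis
    then have "norm (sqrt_iter B m - sqrt_iter B n) < e" if "M \<le> m" "m < n" for m n
    proof -
      have "norm (sqrt_iter B n - sqrt_iter B m) \<le> sqrt_iter_real n - sqrt_iter_real m"
        using dist[of m "n - m"] that by simp
      also have "\<dots> < e"
        using \<open>\<And>m n. M \<le> m \<Longrightarrow> M \<le> n \<Longrightarrow> norm (sqrt_iter_real m - sqrt_iter_real n) < e\<close>[of n m] that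
        by simp
      finally show ?thesis by (simp add: norm_minus_commute)
    qed
    then show "\<exists>M. \<forall>m\<ge>M. \<forall>n>m. dist (sqrt_iter B m) (sqrt_iter B n) < e"
      unfolding dist_norm by blast
  qed
qed

lemma positive_op_sqrt_exists:
  fixes A :: "'a::chilbert_space \<Rightarrow> 'a"
  assumes "bounded_clinear A" "positive_op A"
  shows "\<exists>S. bounded_clinear S \<and> positive_op S \<and> S \<circ> S = A"
proof -
  have A: "bounded_linear A" and AC: "A (c *\<^sub>C x) = c *\<^sub>C A x" for c x
    using assms(1) by (auto simp: bounded_clinear_def)
  \<comment> \<open>The summand 1 keeps \<open>c\<close> positive even for
    \<open>A = 0\<close>.\<close>
  define c where "c = onorm A + 1"
  have c: "0 < c" "onorm A \<le> c"
    using onorm_pos_le[OF A] by (simp_all add: c_def)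
  define B where "B = id_blinfun - (1/c) *\<^sub>R Blinfun A"
  have B_apply: "blinfun_apply B x = x - (1/c) *\<^sub>R A x" for x
    by (simp add: B_def blinfun.bilinear_simps bounded_linear_Blinfun_apply[OF A])
  \<comment> \<open>In the expansion of the squared norm of \<open>B x\<close>,
    \<open>positive_op_norm_sq_le\<close> lets the mixed term dominate the quadratic one.\<close>
  have "norm B \<le> 1"
  proof (rule norm_blinfun_bound)
    fix x
    have "(norm (blinfun_apply B x))\<^sup>2 =
        (norm x)\<^sup>2 - 2 * Re (cinner (A x) x) / c + (norm (A x))\<^sup>2 / c\<^sup>2"
    proof -
      have "Re (cinner x (A x)) = Re (cinner (A x) x)"
        by (metis cinner_commute cnj.sel(1))
      then show ?thesis
        by (simp add: B_apply norm_sq_diff cinner_simps power_divide)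
    qed
    also have "(norm (A x))\<^sup>2 / c\<^sup>2 \<le> Re (cinner (A x) x) / c"
      using positive_op_norm_sq_le[OF assms c, of x] c(1)
      by (simp add: field_simps power2_eq_square)
    also have "(norm x)\<^sup>2 - 2 * Re (cinner (A x) x) / c + Re (cinner (A x) x) / c \<le> (norm x)\<^sup>2"
    proof -
      have "0 \<le> Re (cinner (A x) x) / c"
        using assms(2) c(1) by (simp add: positive_op_def complex_nonneg_Reals_iff)
      then show ?thesis by simp
    qed
    finally show "norm (blinfun_apply B x) \<le> 1 * norm x"
      by simp
  qed simp
  then obtain X where X: "sqrt_iter B \<longlonglongrightarrow> X"
    using Cauchy_sqrt_iter Cauchy_convergent convergent_def by blast
  have X_apply: "(\<lambda>n. blinfun_apply (sqrt_iter B n) x) \<longlonglongrightarrow> blinfun_apply X x" for x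
    by (intro blinfun.tendsto X tendsto_const)
  have "norm X \<le> 1"
    by (rule LIMSEQ_le_const2[OF tendsto_norm[OF X]])
      (use norm_sqrt_iter_le[OF \<open>norm B \<le> 1\<close>] sqrt_iter_real_bounds order_trans in blast)
  \<comment> \<open>Both sides are limits of the shifted sequence, by continuity of
    composition.\<close>
  have fixed: "X = (1/2) *\<^sub>R (B + (X o\<^sub>L X))"
  proof (rule LIMSEQ_unique)
    show "(\<lambda>n. sqrt_iter B (Suc n)) \<longlonglongrightarrow> X"
      using X by (rule LIMSEQ_Suc)
    show "(\<lambda>n. sqrt_iter B (Suc n)) \<longlonglongrightarrow> (1/2) *\<^sub>R (B + (X o\<^sub>L X))"
      unfolding sqrt_iter.simps
      by (intro tendsto_intros bounded_bilinear.tendsto[OF bounded_bilinear_blinfun_compose] X)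
  qed
  have iter_scaleC: "blinfun_apply (sqrt_iter B n) (d *\<^sub>C x) = d *\<^sub>C blinfun_apply (sqrt_iter B n) x"
    for n d x
  proof (induction n arbitrary: x)
    case 0
    \<comment> \<open>The initial iterate is the zero operator, so the claim is that
      \<open>d *\<^sub>C 0\<close> vanishes; its norm shows this.\<close>
    show ?case
      using norm_scaleC[of d "0::'a"] by simp
  next
    case (Suc n)
    show ?case
      by (simp add: blinfun.bilinear_simps B_apply Suc.IH AC scaleC_add_right scaleC_diff_right
          scaleC_scaleR)
  qed
  have iter_sym: "cinner (blinfun_apply (sqrt_iter B n) x) y = cinner x (blinfun_apply (sqrt_iter B n) y)"
    for n x y
    by (induction n arbitrary: x y)
      (simp_all add: blinfun.bilinear_simps B_apply positive_op_symmetric[OF assms] cinner_simps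
        bounded_bilinear.zero_left[OF bounded_bilinear_cinner]
        bounded_bilinear.zero_right[OF bounded_bilinear_cinner])
  have blin_scaleC: "bounded_linear (\<lambda>x::'a. d *\<^sub>C x)" for d
    by standard (auto simp: scaleC_add_right scaleR_scaleC scaleC_scaleC norm_scaleC mult.commute
        intro!: exI[of _ "cmod d"])
  have X_scaleC: "blinfun_apply X (d *\<^sub>C x) = d *\<^sub>C blinfun_apply X x" for d x
    using X_apply[of "d *\<^sub>C x"] bounded_linear.tendsto[OF blin_scaleC X_apply[of x], of d]
    by (auto simp: iter_scaleC intro: LIMSEQ_unique)
  \<comment> \<open>Symmetry of the iterates survives in the limit, so this inner product equals its
    own conjugate.\<close>
  have X_real: "Im (cinner (blinfun_apply X x) x) = 0" for x
  proof -
    have "(\<lambda>n. cinner (blinfun_apply (sqrt_iter B n) x) x) \<longlonglongrightarrow> cinner (blinfun_apply X x) x"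
      "(\<lambda>n. cinner x (blinfun_apply (sqrt_iter B n) x)) \<longlonglongrightarrow> cinner x (blinfun_apply X x)"
      by (intro bounded_bilinear.tendsto[OF bounded_bilinear_cinner] X_apply tendsto_const)+
    then have "cinner (blinfun_apply X x) x = cinner x (blinfun_apply X x)"
      by (simp add: iter_sym LIMSEQ_unique)
    then show ?thesis
      by (metis cinner_commute complex_cnj_cancel_iff Reals_cnj_iff complex_is_Real_iff)
  qed
  define S where "S x = sqrt c *\<^sub>R (x - blinfun_apply X x)" for x
  have "bounded_linear S"
    unfolding S_def
    by (intro bounded_linear_intros)
  moreover have "S (d *\<^sub>C x) = d *\<^sub>C S x" for d x
    by (simp add: S_def X_scaleC scaleC_diff_right scaleC_scaleR)
  moreover have "positive_op S"
    unfolding positive_op_def complex_nonneg_Reals_iff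
  proof (intro allI conjI)
    fix x
    have "Re (cinner (blinfun_apply X x) x) \<le> norm (blinfun_apply X x) * norm x"
      by (rule Re_cinner_le)
    also have "\<dots> \<le> (norm X * norm x) * norm x"
      by (intro mult_right_mono norm_blinfun) simp
    also have "\<dots> \<le> (1 * norm x) * norm x"
      by (intro mult_right_mono \<open>norm X \<le> 1\<close>) simp_all
    finally show "0 \<le> Re (cinner (S x) x)"
      using c(1) by (simp add: S_def cinner_simps cinner_self power2_eq_square)
    show "Im (cinner (S x) x) = 0"
      by (simp add: S_def cinner_simps cinner_self X_real)
  qed
  moreover have "S (S x) = A x" for x
  proof -
    have "blinfun_apply X x = (1/2) *\<^sub>R (blinfun_apply B x + blinfun_apply X (blinfun_apply X x))"
      using arg_cong[OF fixed, of "\<lambda>Y. blinfun_apply Y x"] by (simp add: blinfun.bilinear_simps)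
    then have "2 *\<^sub>R blinfun_apply X x = blinfun_apply B x + blinfun_apply X (blinfun_apply X x)"
      by (metis (no_types) divide_self_if mult.commute scaleR_one scaleR_scaleR times_divide_eq_left zero_neq_numeral)
    \<comment> \<open>Rearranged, the fixed-point equation says that the square of
      \<open>1 - X\<close> is \<open>1 - B\<close>, that is, \<open>A / c\<close>.\<close>
    then have *: "x - blinfun_apply X x - (blinfun_apply X x - blinfun_apply X (blinfun_apply X x)) = (1/c) *\<^sub>R A x"
      by (simp add: B_apply scaleR_2 algebra_simps)
    have "S (S x) = (sqrt c * sqrt c) *\<^sub>R
        (x - blinfun_apply X x - (blinfun_apply X x - blinfun_apply X (blinfun_apply X x)))"
      by (simp add: S_def blinfun.bilinear_simps scaleR_diff_right)
    also have "\<dots> = A x"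
      unfolding * using c(1) by simp
    finally show ?thesis .
  qed
  ultimately show ?thesis
    by (intro exI[of _ S]) (auto simp: bounded_clinear_def)
qed

lemma
  fixes A :: "'a::chilbert_space \<Rightarrow> 'a"
  assumes "bounded_clinear A" "positive_op A"
  shows bounded_clinear_sqrt_op: "bounded_clinear (sqrt_op A)"
    and positive_sqrt_op: "positive_op (sqrt_op A)"
    and sqrt_op_square: "sqrt_op A (sqrt_op A x) = A x"
proof -
  note ex = positive_op_sqrt_exists[OF assms]
  show "bounded_clinear (sqrt_op A)" "positive_op (sqrt_op A)"
    using someI_ex[OF ex] unfolding sqrt_op_def by blast+
  show "sqrt_op A (sqrt_op A x) = A x"
    by (rule sqrt_op_sqrt_op[OF ex])
qed

lemma cinner_sqrt_op:
  fixes A :: "'a::chilbert_space \<Rightarrow> 'a"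
  assumes "bounded_clinear A" "positive_op A"
  shows "cinner (sqrt_op A x) y = cinner x (sqrt_op A y)"
  by (rule positive_op_symmetric[OF bounded_clinear_sqrt_op[OF assms] positive_sqrt_op[OF assms]])

section \<open>Bessel bounds and unconditional convergence\<close>

text \<open>Cauchy criterion along finite subsets: \<open>dom\<close>, applied to the part of
  \<open>F\<close> outside a large \<open>F0\<close>, controls the change in \<open>sum f\<close> by
  a tail of \<open>g\<close>.\<close>

lemma summable_on_dominated_square:
  fixes f :: "'i \<Rightarrow> 'a::banach" and g :: "'i \<Rightarrow> real"
  assumes "g summable_on A" "0 \<le> B"
    and nonneg: "\<And>i. i \<in> A \<Longrightarrow> 0 \<le> g i"
    and dom: "\<And>F. finite F \<Longrightarrow> F \<subseteq> A \<Longrightarrow> (norm (sum f F))\<^sup>2 \<le> B * sum g F"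
  shows "f summable_on A"
proof -
  obtain L where L: "(g has_sum L) A"
    using assms(1) by (auto simp: summable_on_def)
  have "\<exists>P. eventually P (finite_subsets_at_top A) \<and>
      (\<forall>F F'. P F \<and> P F' \<longrightarrow> dist (sum f F) (sum f F') < e)" if "e > 0" for e
  proof -
    \<comment> \<open>Chosen so that \<open>(B + 1) * d\<close> is \<open>(e/2)\<^sup>2\<close>; the
      denominator \<open>B + 1\<close> also covers \<open>B = 0\<close>.\<close>
    define d where "d = (e/2)\<^sup>2 / (B + 1)"
    have "0 < d"
      using \<open>0 < e\<close> \<open>0 \<le> B\<close> by (simp add: d_def)
    then have "eventually (\<lambda>F. dist (sum g F) L < d) (finite_subsets_at_top A)"
      using L by (simp add: has_sum_def tendsto_iff)
    then obtain F0 where F0: "finite F0" "F0 \<subseteq> A" "dist (sum g F0) L < d"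
      unfolding eventually_finite_subsets_at_top by blast
    have near: "norm (sum f F - sum f F0) < e/2" if F: "finite F" "F0 \<subseteq> F" "F \<subseteq> A" for F
    proof -
      have "sum g F \<le> L"
        by (rule finite_sum_le_has_sum[OF L F(1,3)]) (simp add: nonneg)
      then have "sum g (F - F0) \<le> d"
        using F0(3) F by (simp add: sum_diff dist_real_def)
      have "(norm (sum f F - sum f F0))\<^sup>2 = (norm (sum f (F - F0)))\<^sup>2"
        using F by (simp add: sum_diff)
      also have "\<dots> \<le> B * sum g (F - F0)"
        using F by (intro dom) auto
      also have "\<dots> \<le> B * d"
        by (intro mult_left_mono \<open>sum g (F - F0) \<le> d\<close> \<open>0 \<le> B\<close>)
      also have "\<dots> < (B + 1) * d"
        using \<open>0 < d\<close> by (simp add: algebra_simps)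
      also have "\<dots> = (e/2)\<^sup>2"
        using \<open>0 \<le> B\<close> by (simp add: d_def)
      finally show ?thesis
        using \<open>0 < e\<close> by (auto dest: power_less_imp_less_base)
    qed
    have "eventually (\<lambda>F. finite F \<and> F0 \<subseteq> F \<and> F \<subseteq> A) (finite_subsets_at_top A)"
      unfolding eventually_finite_subsets_at_top using F0 by blast
    moreover have "dist (sum f F) (sum f F') < e"
      if "finite F \<and> F0 \<subseteq> F \<and> F \<subseteq> A" "finite F' \<and> F0 \<subseteq> F' \<and> F' \<subseteq> A" for F F'
      using near[of F] near[of F'] that
        norm_triangle_ineq4[of "sum f F - sum f F0" "sum f F' - sum f F0"]
      unfolding dist_norm by simp
    ultimately show ?thesis
      by (intro exI[of _ "\<lambda>F. finite F \<and> F0 \<subseteq> F \<and> F \<subseteq> A"] conjI allI impI) auto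
  qed
  then have "cauchy_filter (filtermap (sum f) (finite_subsets_at_top A))"
    by (simp add: cauchy_filter_metric_filtermap)
  moreover have "complete (UNIV::'a set)"
    by (rule complete_UNIV)
  ultimately obtain L' where "(sum f \<longlongrightarrow> L') (finite_subsets_at_top A)"
    using complete_uniform[where S=UNIV] by (force simp add: filterlim_def)
  then show ?thesis
    using summable_on_def has_sum_def by blast
qed

text \<open>Pairing a finite partial sum \<open>s\<close> with itself and moving each
  \<open>R i\<close> onto \<open>s\<close> allows Cauchy-Schwarz over \<open>F\<close>. The Bessel
  bound at \<open>s\<close> then contributes one factor \<open>norm s\<close>, which
  cancels.\<close>

lemma bessel_synthesis_summable:
  fixes R :: "'i \<Rightarrow> 'a::chilbert_space \<Rightarrow> 'a"
  assumes sym: "\<And>i x y. i \<in> I \<Longrightarrow> cinner (R i x) y = cinner x (R i y)"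
    and "0 \<le> B"
    and bessel: "\<And>F x. finite F \<Longrightarrow> F \<subseteq> I \<Longrightarrow> (\<Sum>i\<in>F. (norm (R i x))\<^sup>2) \<le> B * (norm x)\<^sup>2"
    and "(\<lambda>i. (norm (g i))\<^sup>2) summable_on I"
  shows "(\<lambda>i. R i (g i)) summable_on I"
proof (rule summable_on_dominated_square[OF assms(4) \<open>0 \<le> B\<close>])
  fix F assume F: "finite F" "F \<subseteq> I"
  define s where "s = (\<Sum>i\<in>F. R i (g i))"
  define G where "G = (\<Sum>i\<in>F. (norm (g i))\<^sup>2)"
  have "0 \<le> G" by (simp add: G_def sum_nonneg)
  have "(norm s)\<^sup>2 = Re (cinner s s)"
    by (simp add: cinner_self)
  also have "cinner s s = (\<Sum>i\<in>F. cinner (R i (g i)) s)"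
    using bounded_linear.linear[OF bounded_bilinear.bounded_linear_left[OF bounded_bilinear_cinner]]
    unfolding s_def by (rule linear_sum)
  also have "\<dots> = (\<Sum>i\<in>F. cinner (g i) (R i s))"
    using F sym by (intro sum.cong) auto
  also have "Re \<dots> \<le> (\<Sum>i\<in>F. \<bar>norm (g i)\<bar> * \<bar>norm (R i s)\<bar>)"
    using Re_cinner_le by (auto intro!: sum_mono)
  also have "\<dots> \<le> L2_set (\<lambda>i. norm (g i)) F * L2_set (\<lambda>i. norm (R i s)) F"
    by (rule L2_set_mult_ineq)
  also have "\<dots> \<le> sqrt G * sqrt (B * (norm s)\<^sup>2)"
    unfolding L2_set_def G_def
    by (intro mult_left_mono real_sqrt_le_mono bessel F) (simp add: sum_nonneg)
  finally have le: "norm s * norm s \<le> sqrt (G * B) * norm s"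
    by (simp add: real_sqrt_mult power2_eq_square)
  have "norm s \<le> sqrt (G * B)"
    using le \<open>0 \<le> G\<close> \<open>0 \<le> B\<close> by (cases "s = 0") auto
  then have "(norm s)\<^sup>2 \<le> (sqrt (G * B))\<^sup>2"
    by (intro power_mono) auto
  then show "(norm (\<Sum>i\<in>F. R i (g i)))\<^sup>2 \<le> B * (\<Sum>i\<in>F. (norm (g i))\<^sup>2)"
    using \<open>0 \<le> G\<close> \<open>0 \<le> B\<close> unfolding s_def[symmetric] G_def[symmetric] by (simp add: mult.commute)
qed simp

text \<open>By self-adjointness of the root, each term of the Bessel sum is the squared norm of the
  root applied to \<open>x\<close>. The controlled condition thus becomes an ordinary Bessel bound,
  valid on finite subsets because the terms are nonnegative.\<close>

lemma controlled_g_bessel_roots: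
  fixes C C' :: "'h::chilbert_space \<Rightarrow> 'h" and \<Lambda> :: "'i \<Rightarrow> 'h \<Rightarrow> 'k::chilbert_space"
  assumes C: "bounded_clinear C" "bounded_clinear C'"
    and \<Lambda>: "\<And>i. i \<in> I \<Longrightarrow> bounded_clinear (\<Lambda> i)"
    and pos: "\<And>i. i \<in> I \<Longrightarrow> positive_op (controlled_op C C' (\<Lambda> i))"
    and "controlled_g_bessel C C' I \<Lambda>"
  obtains B where "0 \<le> B"
    and "\<And>x. (\<lambda>i. (norm (controlled_root C C' (\<Lambda> i) x))\<^sup>2) summable_on I"
    and "\<And>F x. finite F \<Longrightarrow> F \<subseteq> I \<Longrightarrow>
      (\<Sum>i\<in>F. (norm (controlled_root C C' (\<Lambda> i) x))\<^sup>2) \<le> B * (norm x)\<^sup>2"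
proof -
  obtain B where B: "\<And>x. \<exists>s::real.
      ((\<lambda>i. cinner (\<Lambda> i (C' x)) (\<Lambda> i (C x))) has_sum complex_of_real s) I \<and> s \<le> B * (norm x)\<^sup>2"
    using assms(5) unfolding controlled_g_bessel_def by blast
  define r where "r i x = (norm (controlled_root C C' (\<Lambda> i) x))\<^sup>2" for i x
  have root: "Re (cinner (\<Lambda> i (C' x)) (\<Lambda> i (C x))) = r i x" if "i \<in> I" for i x
  proof -
    have lin: "bounded_clinear (controlled_op C C' (\<Lambda> i))"
      by (rule bounded_clinear_controlled_op[OF C \<Lambda>[OF that]])
    have "cinner (\<Lambda> i (C' x)) (\<Lambda> i (C x)) = cinner (controlled_op C C' (\<Lambda> i) x) x"
      by (rule cinner_controlled_op[OF C(1) \<Lambda>[OF that], symmetric])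
    also have "\<dots> = cinner (controlled_root C C' (\<Lambda> i) x) (controlled_root C C' (\<Lambda> i) x)"
      by (metis sqrt_op_square[OF lin pos[OF that]] cinner_sqrt_op[OF lin pos[OF that]])
    finally show ?thesis
      by (simp add: cinner_self r_def)
  qed
  have sum: "\<exists>s. ((\<lambda>i. r i x) has_sum s) I \<and> s \<le> B * (norm x)\<^sup>2" for x
  proof -
    obtain s where s: "((\<lambda>i. cinner (\<Lambda> i (C' x)) (\<Lambda> i (C x))) has_sum complex_of_real s) I"
      "s \<le> B * (norm x)\<^sup>2"
      using B by blast
    have "((\<lambda>i. Re (cinner (\<Lambda> i (C' x)) (\<Lambda> i (C x)))) has_sum s) I"
      using has_sum_Re[OF s(1)] by simp
    then have "((\<lambda>i. r i x) has_sum s) I"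
      using root by (simp cong: has_sum_cong)
    with s(2) show ?thesis by blast
  qed
  show ?thesis
  proof
    \<comment> \<open>The Bessel constant may be any real number, whereas the bound passed on is
      nonnegative.\<close>
    show "0 \<le> max B 0" by simp
    show "(\<lambda>i. (norm (controlled_root C C' (\<Lambda> i) x))\<^sup>2) summable_on I" for x
      using sum[of x] unfolding r_def summable_on_def by blast
    show "(\<Sum>i\<in>F. (norm (controlled_root C C' (\<Lambda> i) x))\<^sup>2) \<le> max B 0 * (norm x)\<^sup>2"
      if F: "finite F" "F \<subseteq> I" for F x
    proof -
      obtain s where s: "((\<lambda>i. r i x) has_sum s) I" "s \<le> B * (norm x)\<^sup>2"
        using sum by blast
      have "(\<Sum>i\<in>F. r i x) \<le> s"
        by (rule finite_sum_le_has_sum[OF s(1) F]) (simp add: r_def)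
      also note s(2)
      also have "B * (norm x)\<^sup>2 \<le> max B 0 * (norm x)\<^sup>2"
        by (intro mult_right_mono) simp_all
      finally show ?thesis unfolding r_def .
    qed
  qed
qed

section \<open>The identity for complementary index sets\<close>

theorem theorem4p1:
  fixes C C' :: "'h::chilbert_space \<Rightarrow> 'h"
    and I J :: "'i set"
    and V :: "'i \<Rightarrow> 'k::chilbert_space set"
    and \<Lambda> \<Lambda>' :: "'i \<Rightarrow> 'h \<Rightarrow> 'k"
    and f :: 'h
  assumes "separable_space (euclidean :: 'h topology)"
    and "\<And>i. i \<in> I \<Longrightarrow> csubspace (V i) \<and> closed (V i)"
    and "bounded_invertible C" and "bounded_invertible C'"
    and "bounded_family I V \<Lambda>" and "bounded_family I V \<Lambda>'"
    and "controlled_g_dual_pair C C' I \<Lambda> \<Lambda>'"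
    and "\<And>i. i \<in> I \<Longrightarrow> positive_op (controlled_op C C' (\<Lambda> i))"
    and "\<And>i. i \<in> I \<Longrightarrow> positive_op (controlled_op C C' (\<Lambda>' i))"
    and "J \<subseteq> I"
  shows "(\<Sum>\<^sub>\<infinity>i\<in>J. cinner (controlled_root C C' (\<Lambda>' i) f) (controlled_root C C' (\<Lambda> i) f))
      - complex_of_real ((norm (partial_op C C' \<Lambda> \<Lambda>' J f))\<^sup>2)
    = (\<Sum>\<^sub>\<infinity>i\<in>I - J. cnj (cinner (controlled_root C C' (\<Lambda>' i) f) (controlled_root C C' (\<Lambda> i) f)))
      - complex_of_real ((norm (partial_op C C' \<Lambda> \<Lambda>' (I - J) f))\<^sup>2)"
proof -
  have C: "bounded_clinear C" "bounded_clinear C'"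
    using assms(3,4) by (auto simp: bounded_invertible_def)
  have \<Lambda>: "bounded_clinear (\<Lambda> i)" "bounded_clinear (\<Lambda>' i)" if "i \<in> I" for i
    using assms(5,6) that by (auto simp: bounded_family_def)
  have bessel: "controlled_g_bessel C C' I \<Lambda>" "controlled_g_bessel C C' I \<Lambda>'"
    and dual: "synthesis_op C C' I \<Lambda> \<circ> analysis_op C C' \<Lambda>' = id"
    using assms(7) by (auto simp: controlled_g_dual_pair_def)
  define R R' where "R i = controlled_root C C' (\<Lambda> i)" and "R' i = controlled_root C C' (\<Lambda>' i)" for i
  have sym: "cinner (R i x) y = cinner x (R i y)" if "i \<in> I" for i x y
    unfolding R_def
    by (rule cinner_sqrt_op[OF bounded_clinear_controlled_op[OF C \<Lambda>(1)[OF that]] assms(8)[OF that]])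
  obtain B where B: "0 \<le> B"
    "\<And>F x. finite F \<Longrightarrow> F \<subseteq> I \<Longrightarrow> (\<Sum>i\<in>F. (norm (R i x))\<^sup>2) \<le> B * (norm x)\<^sup>2"
    by (rule controlled_g_bessel_roots[OF C \<Lambda>(1) assms(8) bessel(1)])
      (assumption, assumption, rule that, simp_all add: R_def)
  have "(\<lambda>i. (norm (R' i f))\<^sup>2) summable_on I"
    unfolding R'_def by (rule controlled_g_bessel_roots[OF C \<Lambda>(2) assms(9) bessel(2)]) assumption+
  from bessel_synthesis_summable[OF sym B this]
  have "(\<lambda>i. R i (R' i f)) summable_on I" by simp
  \<comment> \<open>Summability on every part of \<open>I\<close> ensures that \<open>S K\<close> is
    a genuine sum and not the default value 0 of \<open>infsum\<close>.\<close>
  then have summable: "(\<lambda>i. R i (R' i f)) summable_on K" if "K \<subseteq> I" for K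
    using summable_on_subset_banach that by blast
  define S where "S K = (\<Sum>\<^sub>\<infinity>i\<in>K. R i (R' i f))" for K
  have S: "partial_op C C' \<Lambda> \<Lambda>' K f = S K" for K
    by (simp add: partial_op_def S_def R_def R'_def)
  have "S (J \<union> (I - J)) = S J + S (I - J)"
    unfolding S_def by (intro infsum_Un_disjoint summable) (use assms(10) in auto)
  also have "J \<union> (I - J) = I"
    using assms(10) by blast
  also have "S I = f"
    using fun_cong[OF dual, of f]
    by (simp add: synthesis_op_def analysis_op_def S_def R_def R'_def)
  finally have f: "f = S J + S (I - J)" .
  \<comment> \<open>Pairing with \<open>f\<close> is continuous and so passes through the sum; each
    \<open>R i\<close> then moves to the second argument.\<close>
  have inner: "(\<Sum>\<^sub>\<infinity>i\<in>K. cinner (R' i f) (R i f)) = cinner (S K) f" if "K \<subseteq> I" for K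
  proof -
    have "((\<lambda>i. cinner (R i (R' i f)) f) has_sum cinner (S K) f) K"
      unfolding S_def
      by (rule has_sum_bounded_linear[OF bounded_bilinear.bounded_linear_left[OF bounded_bilinear_cinner]])
        (rule has_sum_infsum[OF summable[OF that]])
    then have "(\<Sum>\<^sub>\<infinity>i\<in>K. cinner (R i (R' i f)) f) = cinner (S K) f"
      by (rule infsumI)
    moreover have "(\<Sum>\<^sub>\<infinity>i\<in>K. cinner (R i (R' i f)) f) = (\<Sum>\<^sub>\<infinity>i\<in>K. cinner (R' i f) (R i f))"
      using that by (intro infsum_cong) (auto simp: sym)
    ultimately show ?thesis by simp
  qed
  \<comment> \<open>Splitting \<open>f\<close> in the second argument cancels the squared norm of
    \<open>S J\<close>; the next step splits it in the first argument.\<close>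
  have "cinner (S J) f - complex_of_real ((norm (S J))\<^sup>2) = cinner (S J) (S (I - J))"
    by (subst f) (simp only: cinner_add_right cinner_self add_diff_cancel_left')
  also have "\<dots> = cinner f (S (I - J)) - complex_of_real ((norm (S (I - J)))\<^sup>2)"
    by (subst f) (simp only: cinner_add_left cinner_self add_diff_cancel_right')
  also have "cinner f (S (I - J)) = cnj (cinner (S (I - J)) f)"
    by (rule cinner_commute)
  \<comment> \<open>Conjugation passes through the infinite sum, so \<open>inner\<close> on
    \<open>I - J\<close> evaluates the conjugated sum.\<close>
  finally show ?thesis
    using inner[OF assms(10)] inner[of "I - J"] unfolding S R_def R'_def by simp
qed

end
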